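(* For $i\in\{1,2\}$, let $q_i\in\mathbb Q_{>0}$ and $a_i,b_i\in\mathbb N$. Let $n_2,m_2\in\mathbb Z$. The pattern $$x,\quad y,\quad q_1a_1b_1xy,\quad q_2(a_2x+n_2)(b_2y+m_2)$$ is partition regular if and only if $q_1a_1b_1=q_2a_2b_2$ and at least one of the following holds: 1. $n_2=m_2=0$; 2. $n_2=0$ and $q_2a_2m_2=1$; 3. $m_2=0$ and $q_2b_2n_2=1$.
   Context: $\mathbb N$ denotes the set of positive integers ($0\notin\mathbb N$). A pattern $f_1(x,y),\dots,f_k(x,y)$ (with the $f_i$ rational-valued functions) is called partition regular if, for every finite colouring (partition into finitely many pieces) of $\mathbb N$, the set of monochromatic $k$-tuples $(f_1(u,v),\dots,f_k(u,v))$ with $u,v\in\mathbb N$ is infinite; here a tuple is monochromatic if all its entries belong to $\mathbb N$ and lie in the same colour. *)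

theory Defs
  imports Complex_Main "HOL-Library.Disjoint_Sets"
begin

text \<open>The positive integers are the naturals in \<^term>\<open>{0<..}\<close>. A finite colouring of them is a
  finite partition, whose members are the colour classes.\<close>

definition finite_colouring :: "nat set set \<Rightarrow> bool" where
  "finite_colouring C \<longleftrightarrow> finite C \<and> partition_on {0<..} C"

text \<open>Tuples have rational entries. Since every class consists of positive integers, containment in
  the image of one class also forces all entries to be positive integers.\<close>

definition monochromatic :: "nat set set \<Rightarrow> rat list \<Rightarrow> bool" where
  "monochromatic C t \<longleftrightarrow> (\<exists>A\<in>C. set t \<subseteq> of_nat ` A)"

text \<open>The infinitude condition is on the set of tuples of values, not on the set of pairs
  \<^term>\<open>(u, v)\<close>.\<close>

definition partition_regular :: "(nat \<Rightarrow> nat \<Rightarrow> rat) list \<Rightarrow> bool" where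
  "partition_regular fs \<longleftrightarrow>
     (\<forall>C. finite_colouring C \<longrightarrow>
        infinite {t. \<exists>u v. 0 < u \<and> 0 < v \<and> t = map (\<lambda>f. f u v) fs \<and> monochromatic C t})"

end

theory Submission
  imports Defs "HOL-Library.Ramsey" "HOL-Computational_Algebra.Primes"
begin

text \<open>Sufficiency reduces to the pattern \<open>x, y, w, w + x\<close> with \<open>w = (C / D) x y\<close>. Call a class good if it is
  multiplicatively piecewise syndetic, and let \<open>U\<close> be the union of the good classes. Finitely many
  numbers, however far apart, can be moved into \<open>U\<close> by one common multiplier taken from a finite set
  fixed in advance. This yields arbitrarily long sequences \<open>u\<close> such that, for \<open>i < j < k\<close>,
  \<open>u k - u j = C v (u j - u i)\<close> with \<open>D v\<close> in \<open>U\<close>. For each good class some dilate of all the differences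
  falls into the class up to multipliers from a finite set; colouring pairs \<open>i < j\<close> by these multipliers,
  for all good classes simultaneously, Ramsey's theorem gives \<open>i < j < k\<close> with equal multipliers. Then
  \<open>y = D v\<close>, and \<open>x, w, w + x\<close> are the common dilates of \<open>u j - u i, u k - u j, u k - u i\<close>.

  For necessity, colouring by \<open>\<lfloor>log n\<rfloor> mod 4\<close> in a suitable base separates different leading
  coefficients. After that a single large prime \<open>p\<close> suffices: the colour of \<open>n\<close> records whether \<open>p\<close>
  divides \<open>n\<close> and the last nonzero \<open>p\<close>-adic digits of \<open>n\<close> and of \<open>c n - 1\<close>, where \<open>c\<close> is the common
  leading coefficient.\<close>

section \<open>Multiplicatively piecewise syndetic sets\<close>

definition mult_pws :: "nat set \<Rightarrow> bool" where
  "mult_pws A \<longleftrightarrow> (\<exists>T. finite T \<and> 0 \<notin> T \<and>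
     (\<forall>W. finite W \<and> 0 \<notin> W \<longrightarrow> (\<exists>z>0. \<forall>w\<in>W. \<exists>t\<in>T. z * w * t \<in> A)))"

lemma not_mult_pws_empty: "\<not> mult_pws {}"
proof
  assume "mult_pws {}"
  then obtain T where "\<forall>W. finite W \<and> (0::nat) \<notin> W \<longrightarrow> (\<exists>z>0. \<forall>w\<in>W. \<exists>t\<in>T. z * w * t \<in> {})"
    unfolding mult_pws_def by (elim exE conjE)
  from spec[OF this, of "{1}"] show False by simp
qed

lemma common_multiplier_list:
  assumes "finite \<V>" and "\<And>V. V \<in> \<V> \<Longrightarrow> \<not> mult_pws V"
  shows "\<exists>R. finite R \<and> 0 \<notin> R \<and>
     (\<forall>ps. length ps \<le> L \<and> set ps \<subseteq> {0<..} \<times> \<V> \<longrightarrow> (\<exists>\<rho>\<in>R. \<forall>(\<theta>, V)\<in>set ps. \<rho> * \<theta> \<notin> V))"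
proof (induction L)
  case 0
  show ?case by (rule exI[of _ "{1}"]) auto
next
  case (Suc L)
  then obtain R where R: "finite R" "0 \<notin> R" and
    IH: "\<forall>ps. length ps \<le> L \<and> set ps \<subseteq> {0<..} \<times> \<V> \<longrightarrow> (\<exists>\<rho>\<in>R. \<forall>(\<theta>, V)\<in>set ps. \<rho> * \<theta> \<notin> V)"
    by (elim exE conjE)
  have "\<exists>W. finite W \<and> 0 \<notin> W \<and> (\<forall>z>0. \<exists>w\<in>W. \<forall>t\<in>R. z * w * t \<notin> V)" if "V \<in> \<V>" for V
  proof -
    have "\<not> (finite R \<and> 0 \<notin> R \<and>
        (\<forall>W. finite W \<and> 0 \<notin> W \<longrightarrow> (\<exists>z>0. \<forall>w\<in>W. \<exists>t\<in>R. z * w * t \<in> V)))"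
      using assms(2)[OF that] unfolding mult_pws_def by (rule contrapos_nn) (rule exI)
    then show ?thesis using R by (simp add: disj_imp)
  qed
  then obtain W where W: "\<And>V. V \<in> \<V> \<Longrightarrow> finite (W V) \<and> 0 \<notin> W V \<and>
      (\<forall>z>0. \<exists>w\<in>W V. \<forall>t\<in>R. z * w * t \<notin> V)"
    by metis
  define R' where "R' = R \<union> (\<lambda>(w, r). w * r) ` ((\<Union>V\<in>\<V>. W V) \<times> R)"
  have R': "finite R'" "0 \<notin> R'"
    using R W assms(1) by (auto simp: R'_def)
  have main: "\<exists>\<rho>\<in>R'. \<forall>(\<theta>, V)\<in>set ps. \<rho> * \<theta> \<notin> V"
    if ps: "length ps \<le> Suc L" "set ps \<subseteq> {0<..} \<times> \<V>" for ps
  proof (cases ps)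
    case Nil
    then show ?thesis using IH[rule_format, of "[]"] by (auto simp: R'_def)
  next
    case (Cons p qs)
    obtain \<theta> V where p: "p = (\<theta>, V)" by fastforce
    have "\<theta> > 0" "V \<in> \<V>" using ps Cons p by auto
    then obtain w where w: "w \<in> W V" "\<And>t. t \<in> R \<Longrightarrow> \<theta> * w * t \<notin> V"
      using W by blast
    have "w > 0" using w(1) W[OF \<open>V \<in> \<V>\<close>] by (metis gr0I)
    define qs' where "qs' = map (\<lambda>(\<theta>', V'). (w * \<theta>', V')) qs"
    have "length qs' \<le> L" using ps(1) Cons by (simp add: qs'_def)
    moreover have "set qs' \<subseteq> {0<..} \<times> \<V>"
      using ps(2) Cons \<open>w > 0\<close> by (auto simp: qs'_def)
    ultimately obtain \<rho> where \<rho>: "\<rho> \<in> R" "\<forall>(\<theta>', V')\<in>set qs'. \<rho> * \<theta>' \<notin> V'"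
      using IH by meson
    have "w * \<rho> \<in> R'"
      using w(1) \<rho>(1) \<open>V \<in> \<V>\<close> unfolding R'_def by force
    moreover have "\<forall>(\<theta>', V')\<in>set ps. w * \<rho> * \<theta>' \<notin> V'"
      using \<rho> w(2)[OF \<rho>(1)] by (fastforce simp: Cons p qs'_def mult_ac)
    ultimately show ?thesis by blast
  qed
  show ?case
  proof (intro exI[of _ R'] conjI allI impI R')
    fix ps :: "(nat \<times> nat set) list" assume "length ps \<le> Suc L \<and> set ps \<subseteq> {0<..} \<times> \<V>"
    then show "\<exists>\<rho>\<in>R'. \<forall>(\<theta>, V)\<in>set ps. \<rho> * \<theta> \<notin> V" by (elim conjE) (rule main)
  qed
qed

lemma common_multiplier:
  assumes "finite \<V>" and "\<And>V. V \<in> \<V> \<Longrightarrow> \<not> mult_pws V"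
  shows "\<exists>R. finite R \<and> 0 \<notin> R \<and>
     (\<forall>\<Theta>. finite \<Theta> \<and> 0 \<notin> \<Theta> \<and> card \<Theta> \<le> L \<longrightarrow> (\<exists>\<rho>\<in>R. \<forall>\<theta>\<in>\<Theta>. \<rho> * \<theta> \<notin> \<Union>\<V>))"
proof -
  obtain R where R: "finite R" "0 \<notin> R" and
    rob: "\<And>ps. length ps \<le> L * card \<V> \<Longrightarrow> set ps \<subseteq> {0<..} \<times> \<V> \<Longrightarrow>
      \<exists>\<rho>\<in>R. \<forall>(\<theta>, V)\<in>set ps. \<rho> * \<theta> \<notin> V"
    using common_multiplier_list[OF assms, where L = "L * card \<V>"] by blast
  have "\<exists>\<rho>\<in>R. \<forall>\<theta>\<in>\<Theta>. \<rho> * \<theta> \<notin> \<Union>\<V>" if \<Theta>: "finite \<Theta>" "0 \<notin> \<Theta>" "card \<Theta> \<le> L" for \<Theta>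
  proof -
    obtain ps where ps: "set ps = \<Theta> \<times> \<V>" "distinct ps"
      using finite_distinct_list[of "\<Theta> \<times> \<V>"] \<Theta>(1) assms(1) by blast
    have "length ps = card \<Theta> * card \<V>"
      using distinct_card[OF ps(2)] ps(1) by (simp add: card_cartesian_product)
    then have "length ps \<le> L * card \<V>" using \<Theta>(3) by simp
    moreover have "set ps \<subseteq> {0<..} \<times> \<V>" using ps(1) \<Theta>(2) by (auto intro: gr0I)
    ultimately obtain \<rho> where "\<rho> \<in> R" "\<forall>(\<theta>, V)\<in>set ps. \<rho> * \<theta> \<notin> V"
      using rob by blast
    then show ?thesis by (intro bexI[of _ \<rho>]) (auto simp: ps(1))
  qed
  then show ?thesis using R by blast
qed

section \<open>The pattern of a product and its shift\<close>

text \<open>A new first gap is prepended in the induction step. Its multiplier is chosen last, but it ranges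
  over a finite set \<open>R\<close> known before the rest of the sequence is built; so the rest can be built to suit
  every candidate at once. The set \<open>X\<close> (in units of \<open>1 / q\<close>) carries the distances from the current
  starting point back to the earlier points, over all candidates for the earlier gaps.\<close>

lemma sequence_with_ratios:
  fixes U :: "nat set" and C D n :: nat
  assumes rob: "\<And>L. \<exists>R. finite R \<and> 0 \<notin> R \<and>
      (\<forall>\<Theta>. finite \<Theta> \<and> 0 \<notin> \<Theta> \<and> card \<Theta> \<le> L \<longrightarrow> (\<exists>\<rho>\<in>R. \<forall>\<theta>\<in>\<Theta>. \<rho> * \<theta> \<in> U))"
    and "C > 0" "D > 0" and "finite X" "q > 0"
  shows "\<exists>u. u 0 = 0 \<and> strict_mono u \<and>
     (\<forall>x\<in>X. \<forall>j k. 0 < j \<and> j < k \<and> k \<le> n \<longrightarrow>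
        (\<exists>v>0. D * v \<in> U \<and> q * u k = q * u j + C * v * (q * u j + x))) \<and>
     (\<forall>i j k. i < j \<and> j < k \<and> k \<le> n \<longrightarrow>
        (\<exists>v>0. D * v \<in> U \<and> u k + C * v * u i = u j + C * v * u j))"
  using assms(4,5)
proof (induction n arbitrary: X q)
  case 0
  show ?case by (rule exI[of _ id]) (simp add: strict_mono_def)
next
  case (Suc n)
  define X0 where "X0 = insert 0 X"
  have X0: "finite X0" using Suc.prems by (simp add: X0_def)
  define E where "E = (\<Prod>x\<in>X0. q + x)"
  have "E > 0" using X0 \<open>q > 0\<close> by (simp add: E_def prod_pos)
  have E_div: "E div (q + x) * (q + x) = E" if "x \<in> X0" for x
    using that X0 by (simp add: E_def dvd_prodI)
  from rob[of "card X0 * n"] obtain R where R: "finite R" "0 \<notin> R" and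
    R_rob: "\<forall>\<Theta>. finite \<Theta> \<and> 0 \<notin> \<Theta> \<and> card \<Theta> \<le> card X0 * n \<longrightarrow> (\<exists>\<rho>\<in>R. \<forall>\<theta>\<in>\<Theta>. \<rho> * \<theta> \<in> U)"
    by (elim exE conjE)
  define P where "P = (\<Prod>r\<in>R. C * E * r)"
  have "P > 0" using R \<open>C > 0\<close> \<open>E > 0\<close> unfolding P_def by (intro prod_pos) (auto intro: gr0I)
  have P_div: "C * E * r * (P div (C * E * r)) = P" if "r \<in> R" for r
    unfolding P_def using dvd_prodI[OF R(1) that, of "\<lambda>r. C * E * r"] by (rule dvd_mult_div_cancel)
  define X' where "X' = (\<lambda>(x, r). (q + x) * (P div (C * E * r))) ` (X0 \<times> R)"
  have "finite X'" "q * P > 0" using X0 R \<open>q > 0\<close> \<open>P > 0\<close> by (auto simp: X'_def)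
  from Suc.IH[OF this] obtain v where v0: "v 0 = 0" and v_mono: "strict_mono v" and
    ext: "\<forall>x\<in>X'. \<forall>j k. 0 < j \<and> j < k \<and> k \<le> n \<longrightarrow>
       (\<exists>m>0. D * m \<in> U \<and> q * P * v k = q * P * v j + C * m * (q * P * v j + x))" and
    int: "\<forall>i j k. i < j \<and> j < k \<and> k \<le> n \<longrightarrow>
       (\<exists>m>0. D * m \<in> U \<and> v k + C * m * v i = v j + C * m * v j)"
    by (elim exE conjE)
  have v_pos: "v k > 0" if "k > 0" for k
    using strict_monoD[OF v_mono that] v0 by simp
  define \<Theta> where "\<Theta> = (\<lambda>(x, k). D * (v k * q * (E div (q + x)))) ` (X0 \<times> {1..n})"
  have "E div (q + x) > 0" if "x \<in> X0" for x
    using E_div[OF that] \<open>E > 0\<close> by (metis gr0I mult_0 less_irrefl)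
  then have "D * (v k * q * (E div (q + x))) > 0" if "x \<in> X0" "k \<in> {1..n}" for x k
    using that v_pos \<open>D > 0\<close> \<open>q > 0\<close> by simp
  then have "0 \<notin> \<Theta>" unfolding \<Theta>_def by fastforce
  moreover have "finite \<Theta>" using X0 by (simp add: \<Theta>_def)
  moreover have "card \<Theta> \<le> card X0 * n"
    using card_image_le[of "X0 \<times> {1..n}" "\<lambda>(x, k). D * (v k * q * (E div (q + x)))"] X0
    by (simp add: \<Theta>_def card_cartesian_product)
  ultimately have "\<exists>r\<in>R. \<forall>\<theta>\<in>\<Theta>. r * \<theta> \<in> U" by (intro R_rob[rule_format] conjI)
  then obtain r where r: "r \<in> R" and r_U: "\<forall>\<theta>\<in>\<Theta>. r * \<theta> \<in> U"
    by (rule bexE)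
  have "r > 0" using r R by (metis gr0I)
  define \<rho> where "\<rho> = C * E * r"
  have "\<rho> > 0" using \<open>r > 0\<close> \<open>C > 0\<close> \<open>E > 0\<close> by (simp add: \<rho>_def)
  define P' where "P' = P div \<rho>"
  have P': "P = \<rho> * P'" using P_div[OF r] by (simp add: P'_def \<rho>_def)
  have "P' > 0" using P' \<open>P > 0\<close> by (metis gr0I mult_0_right less_irrefl)
  define u where "u = (\<lambda>j. case j of 0 \<Rightarrow> 0 | Suc j \<Rightarrow> 1 + \<rho> * v j)"
  have u0: "u 0 = 0" and uS: "\<And>j. u (Suc j) = 1 + \<rho> * v j" by (simp_all add: u_def)
  have "u j < u (Suc j)" for j
    using strict_monoD[OF v_mono] \<open>\<rho> > 0\<close> by (cases j) (simp_all add: u0 uS)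
  then have u_mono: "strict_mono u" by (simp add: strict_mono_Suc_iff)
  have u_ext: "\<exists>m>0. D * m \<in> U \<and> q * u k = q * u j + C * m * (q * u j + x)"
    if x: "x \<in> X0" and lt: "0 < j" "j < k" "k \<le> Suc n" for x j k
  proof -
    obtain j' where j: "j = Suc j'" using lt by (cases j) auto
    obtain k' where k: "k = Suc k'" using lt by (cases k) auto
    note jk = j k
    show ?thesis
    proof (cases "j' = 0")
      case True
      define m where "m = r * (v k' * q * (E div (q + x)))"
      have "k' \<in> {1..n}" using lt jk True by auto
      then have "D * (v k' * q * (E div (q + x))) \<in> \<Theta>"
        using x unfolding \<Theta>_def by force
      from bspec[OF r_U this] have "D * m \<in> U" by (simp add: m_def mult_ac)
      moreover have "q * u k = q * u j + C * m * (q * u j + x)"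
      proof -
        have "C * m * (q + x) = C * r * v k' * q * (E div (q + x) * (q + x))"
          by (simp add: m_def)
        also have "\<dots> = q * \<rho> * v k'" by (simp add: E_div[OF x] \<rho>_def)
        finally show ?thesis by (simp add: jk True uS v0 distrib_left)
      qed
      moreover have "m > 0"
        using \<open>r > 0\<close> v_pos \<open>k' \<in> {1..n}\<close> \<open>q > 0\<close> E_div[OF x] \<open>E > 0\<close>
        by (auto simp: m_def intro!: gr0I)
      ultimately show ?thesis by blast
    next
      case False
      have "(q + x) * P' \<in> X'"
        using x r unfolding X'_def P'_def \<rho>_def by force
      then obtain m where m: "m > 0" "D * m \<in> U"
        "q * P * v k' = q * P * v j' + C * m * (q * P * v j' + (q + x) * P')"
        using ext[rule_format, of "(q + x) * P'" j' k'] False lt jk by auto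
      have "P' * (q * u k) = P' * (q * u j + C * m * (q * u j + x))"
        using m(3) by (simp add: jk uS P' algebra_simps)
      then show ?thesis using m(1,2) \<open>P' > 0\<close> by auto
    qed
  qed
  have u_int: "\<exists>m>0. D * m \<in> U \<and> u k + C * m * u i = u j + C * m * u j"
    if lt: "i < j" "j < k" "k \<le> Suc n" for i j k
  proof (cases i)
    case 0
    then obtain m where m: "m > 0" "D * m \<in> U" "q * u k = q * u j + C * m * (q * u j + 0)"
      using u_ext[of 0 j k] lt by (auto simp: X0_def)
    have "q * u k = q * (u j + C * m * u j)" using m(3) by (simp add: algebra_simps)
    then have "u k = u j + C * m * u j" using \<open>q > 0\<close> by simp
    then show ?thesis using m(1,2) by (auto simp: 0 u0)
  next
    case (Suc i')
    obtain j' where j: "j = Suc j'" using lt by (cases j) auto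
    obtain k' where k: "k = Suc k'" using lt by (cases k) auto
    note jk = j k
    then obtain m where m: "m > 0" "D * m \<in> U" "v k' + C * m * v i' = v j' + C * m * v j'"
      using int[rule_format, of i' j' k'] lt Suc by auto
    have "\<rho> * (v k' + C * m * v i') = \<rho> * (v j' + C * m * v j')" using m(3) by simp
    then have "u k + C * m * u i = u j + C * m * u j"
      by (simp add: jk Suc uS algebra_simps)
    then show ?thesis using m(1,2) by blast
  qed
  show ?case
    using u0 u_mono u_ext u_int by (intro exI[of _ u]) (simp add: X0_def)
qed

lemma ramsey_triangle:
  assumes "finite S"
  shows "\<exists>N::nat. \<forall>f. (\<forall>i j. i < j \<and> j < N \<longrightarrow> f i j \<in> S) \<longrightarrow>
    (\<exists>i j k. i < j \<and> j < k \<and> k < N \<and> f i j = f j k \<and> f i j = f i k)"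
proof -
  obtain idx where idx: "inj_on idx S" "idx ` S = {..<card S}"
    using ex_bij_betw_finite_nat[OF assms] by (auto simp: bij_betw_def lessThan_atLeast0)
  obtain N :: nat where N: "partn_lst {..<N} (replicate (card S) 3) 2"
    using ramsey_full by blast
  have "\<exists>i j k. i < j \<and> j < k \<and> k < N \<and> f i j = f j k \<and> f i j = f i k"
    if f: "\<forall>i j. i < j \<and> j < N \<longrightarrow> f i j \<in> S" for f
  proof -
    define g where "g e = idx (f (Min e) (Max e))" for e
    have g: "g {i, j} = idx (f i j)" if "i < j" for i j
      using that by (simp add: g_def)
    have "g \<in> nsets {..<N} 2 \<rightarrow> {..<card S}"
    proof
      fix e assume "e \<in> nsets {..<N} 2"
      then obtain i j where "e = {i, j}" "i < j" "j < N"
        by (auto simp: nsets_2_eq) (metis insert_commute linorder_neqE_nat)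
      then show "g e \<in> {..<card S}" using f idx g by blast
    qed
    then obtain c H where "c < card S" "H \<in> nsets {..<N} 3" and mono: "g ` nsets H 2 \<subseteq> {c}"
      using partn_lstE[OF N, of g "card S"] by (metis length_replicate nth_replicate)
    then have H: "H \<subseteq> {..<N}" "card H = 3" "finite H" by (auto simp: nsets_def)
    define xs where "xs = sorted_list_of_set H"
    have "sorted_wrt (<) xs" "set xs = H" "length xs = 3"
      using H by (simp_all add: xs_def)
    then obtain i j k where ijk: "i < j" "j < k" "k < N" "{i, j, k} = H"
      using H(1) by (auto simp: numeral_3_eq_3 length_Suc_conv)
    then have "{i, j} \<in> nsets H 2" "{j, k} \<in> nsets H 2" "{i, k} \<in> nsets H 2"
      by (auto simp: nsets_def)
    with mono ijk g have "idx (f i j) = idx (f j k)" "idx (f i j) = idx (f i k)"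
      by (metis image_subset_iff less_trans singletonD)+
    then have "f i j = f j k" "f i j = f i k"
      using inj_onD[OF idx(1)] f ijk by (meson less_trans)+
    then show ?thesis using ijk by blast
  qed
  then show ?thesis by - (rule exI[of _ N], intro allI impI)
qed

theorem monochromatic_product_and_shift:
  fixes \<chi> :: "nat \<Rightarrow> 'c" and C D :: nat
  assumes "finite (range \<chi>)" "C > 0" "D > 0"
  shows "\<exists>x y w. 0 < x \<and> 0 < y \<and> 0 < w \<and> D * w = C * x * y \<and>
    \<chi> y = \<chi> x \<and> \<chi> w = \<chi> x \<and> \<chi> (w + x) = \<chi> x"
proof -
  define A where "A c = {n. 0 < n \<and> \<chi> n = c}" for c
  define G where "G = {c. mult_pws (A c)}"
  have "G \<subseteq> range \<chi>"
  proof
    fix c assume "c \<in> G"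
    then have "A c \<noteq> {}" using not_mult_pws_empty by (auto simp: G_def)
    then show "c \<in> range \<chi>" by (auto simp: A_def)
  qed
  then have "finite G" using assms(1) finite_subset by blast
  define U where "U = - \<Union>(A ` (range \<chi> - G))"
  have "\<exists>R. finite R \<and> 0 \<notin> R \<and>
      (\<forall>\<Theta>. finite \<Theta> \<and> 0 \<notin> \<Theta> \<and> card \<Theta> \<le> L \<longrightarrow> (\<exists>\<rho>\<in>R. \<forall>\<theta>\<in>\<Theta>. \<rho> * \<theta> \<in> U))" for L
    unfolding U_def Compl_iff by (rule common_multiplier) (use assms(1) in \<open>auto simp: G_def\<close>)
  note seq = sequence_with_ratios[OF this assms(2,3), of "{}" 1]
  have "\<exists>T. \<forall>c\<in>G. finite (T c) \<and> 0 \<notin> T c \<and>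
      (\<forall>W. finite W \<and> 0 \<notin> W \<longrightarrow> (\<exists>z>0. \<forall>w\<in>W. \<exists>t\<in>T c. z * w * t \<in> A c))"
    by (rule bchoice) (simp add: G_def mult_pws_def)
  then obtain T where T: "\<forall>c\<in>G. finite (T c) \<and> 0 \<notin> T c \<and>
      (\<forall>W. finite W \<and> 0 \<notin> W \<longrightarrow> (\<exists>z>0. \<forall>w\<in>W. \<exists>t\<in>T c. z * w * t \<in> A c))"
    by (rule exE)
  have "finite (Pi\<^sub>E G T)" using \<open>finite G\<close> T by (simp add: finite_PiE)
  from ramsey_triangle[OF this] obtain N :: nat where N: "\<forall>f. (\<forall>i j. i < j \<and> j < N \<longrightarrow> f i j \<in> Pi\<^sub>E G T) \<longrightarrow>
      (\<exists>i j k. i < j \<and> j < k \<and> k < N \<and> f i j = f j k \<and> f i j = f i k)"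
    by (rule exE)
  obtain u where u: "strict_mono u" and
    ratio: "\<forall>i j k. i < j \<and> j < k \<and> k \<le> N \<longrightarrow>
      (\<exists>v>0. D * v \<in> U \<and> u k + C * v * u i = u j + C * v * u j)"
    using seq[of N] by auto
  define W where "W = (\<lambda>(i, j). u j - u i) ` {(i, j). i < j \<and> j < N}"
  have "finite {(i, j). i < j \<and> j < N}"
    by (rule finite_subset[of _ "{..<N} \<times> {..<N}"]) auto
  then have "finite W" by (simp add: W_def)
  moreover have "0 \<notin> W" using strict_monoD[OF u] by (force simp: W_def)
  ultimately have "\<exists>z. \<forall>c\<in>G. 0 < z c \<and> (\<forall>w\<in>W. \<exists>t\<in>T c. z c * w * t \<in> A c)"
    using T by (intro bchoice) simp
  then obtain z where z: "\<forall>c\<in>G. 0 < z c \<and> (\<forall>w\<in>W. \<exists>t\<in>T c. z c * w * t \<in> A c)"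
    by (rule exE)
  define t where "t c i j = (SOME t. t \<in> T c \<and> z c * (u j - u i) * t \<in> A c)" for c i j
  have t: "t c i j \<in> T c \<and> z c * (u j - u i) * t c i j \<in> A c" if "c \<in> G" "i < j" "j < N" for c i j
  proof -
    have "u j - u i \<in> W" using that(2,3) unfolding W_def by force
    then have "\<exists>t. t \<in> T c \<and> z c * (u j - u i) * t \<in> A c" using z that(1) by auto
    then show ?thesis unfolding t_def by (rule someI_ex)
  qed
  define f where "f i j = (\<lambda>c\<in>G. t c i j)" for i j
  have "f i j \<in> Pi\<^sub>E G T" if "i < j" "j < N" for i j
    using t that by (auto simp: f_def)
  then have "\<exists>i j k. i < j \<and> j < k \<and> k < N \<and> f i j = f j k \<and> f i j = f i k"
    using N[rule_format, of f] by simp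
  then obtain i j k where ijk: "i < j" "j < k" "k < N" and f: "f i j = f j k" "f i j = f i k"
    by (elim exE conjE)
  obtain v where v: "v > 0" "D * v \<in> U" "u k + C * v * u i = u j + C * v * u j"
    using ratio[rule_format, of i j k] ijk by auto
  define c where "c = \<chi> (D * v)"
  have c: "c \<in> G" using v assms by (auto simp: U_def c_def A_def)
  define s where "s = t c i j"
  have s: "t c j k = s" "t c i k = s"
    using f c unfolding f_def s_def by (metis restrict_apply')+
  have lt: "u i < u j" "u j < u k" using ijk strict_monoD[OF u] by auto
  define x where "x = z c * (u j - u i) * s"
  define w where "w = z c * (u k - u j) * s"
  have "x \<in> A c" using t[OF c, of i j] ijk by (simp add: x_def s_def)
  moreover have "w \<in> A c" using t[OF c, of j k] ijk s by (simp add: w_def)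
  moreover have "w + x = z c * (u k - u i) * s"
    using lt by (simp add: w_def x_def flip: distrib_left distrib_right)
  then have "w + x \<in> A c" using t[OF c, of i k] ijk s by simp
  moreover have "u k - u j = C * v * (u j - u i)"
    using v(3) lt by (simp add: diff_mult_distrib2)
  then have "D * w = C * x * (D * v)" by (simp add: w_def x_def)
  moreover have "0 < D * v" using v(1) assms by simp
  ultimately show ?thesis
    by (intro exI[of _ x] exI[of _ "D * v"] exI[of _ w]) (auto simp: A_def c_def)
qed

section \<open>Partition regularity and colourings as functions\<close>

text \<open>Giving every number up to \<open>M\<close> its own colour confines the tuples with a small entry to \<open>x = y \<le> M\<close>,
  a finite set.\<close>

lemma partition_regular_large:
  fixes \<chi> :: "nat \<Rightarrow> 'c" and F G :: "nat \<Rightarrow> nat \<Rightarrow> rat"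
  assumes PR: "partition_regular [\<lambda>x y. of_nat x, \<lambda>x y. of_nat y, F, G]"
    and fin: "finite (range \<chi>)"
  obtains x y w z where "M < x" "M < y" "M < w" "M < z" "F x y = of_nat w" "G x y = of_nat z"
    "\<chi> y = \<chi> x" "\<chi> w = \<chi> x" "\<chi> z = \<chi> x"
proof -
  define \<kappa> where "\<kappa> n = (\<chi> n, min n (Suc M))" for n
  define cls where "cls c = {m. 0 < m \<and> \<kappa> m = c}" for c
  define C where "C = cls ` \<kappa> ` {0<..}"
  have "range \<kappa> \<subseteq> range \<chi> \<times> {..Suc M}" by (auto simp: \<kappa>_def)
  then have "finite (range \<kappa>)" by (rule finite_subset) (simp add: fin)
  then have "finite C" unfolding C_def by (meson finite_imageI finite_subset image_mono subset_UNIV)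
  moreover have "partition_on {0<..} C"
    by (rule partition_onI) (auto simp: C_def cls_def disjnt_def)
  ultimately have "finite_colouring C" by (simp add: finite_colouring_def)
  define S where "S = {t. \<exists>u v. 0 < u \<and> 0 < v \<and>
    t = map (\<lambda>f. f u v) [\<lambda>x y. of_nat x, \<lambda>x y. of_nat y, F, G] \<and> Defs.monochromatic C t}"
  have "infinite S" using PR \<open>finite_colouring C\<close> unfolding partition_regular_def S_def by blast
  then have "\<not> S \<subseteq> (\<lambda>x. [of_nat x, of_nat x, F x x, G x x]) ` {..M}"
    using finite_subset by blast
  then obtain t where t: "t \<in> S" "t \<notin> (\<lambda>x. [of_nat x, of_nat x, F x x, G x x]) ` {..M}" by blast
  from t(1) obtain x y A where xy: "t = [of_nat x, of_nat y, F x y, G x y]" "A \<in> C"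
    "set t \<subseteq> of_nat ` A"
    unfolding S_def Defs.monochromatic_def by auto
  then obtain w z where wz: "F x y = of_nat w" "G x y = of_nat z" "w \<in> A" "z \<in> A" by auto
  have "x \<in> A" "y \<in> A" using xy by auto
  then have eq: "\<kappa> y = \<kappa> x" "\<kappa> w = \<kappa> x" "\<kappa> z = \<kappa> x"
    using wz \<open>A \<in> C\<close> by (auto simp: C_def cls_def)
  have "M < x"
  proof (rule ccontr)
    assume "\<not> M < x"
    then have "y = x" using eq(1) by (auto simp: \<kappa>_def min_def split: if_splits)
    then show False using t(2) xy(1) \<open>\<not> M < x\<close> by auto
  qed
  then have "M < y" "M < w" "M < z" using eq by (auto simp: \<kappa>_def min_def split: if_splits)
  then show thesis using that \<open>M < x\<close> wz eq by (simp add: \<kappa>_def)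
qed

lemma partition_regularI_large:
  fixes F G :: "nat \<Rightarrow> nat \<Rightarrow> rat"
  assumes "\<And>(\<chi> :: nat \<Rightarrow> nat set set) M. finite (range \<chi>) \<Longrightarrow>
    \<exists>x y w z. M < x \<and> M < y \<and> F x y = of_nat w \<and> G x y = of_nat z \<and>
      \<chi> y = \<chi> x \<and> \<chi> w = \<chi> x \<and> \<chi> z = \<chi> x"
  shows "partition_regular [\<lambda>x y. of_nat x, \<lambda>x y. of_nat y, F, G]"
  unfolding partition_regular_def
proof (intro allI impI)
  fix C assume C: "finite_colouring C"
  define \<chi> where "\<chi> n = {A \<in> C. n \<in> A}" for n
  have "finite (range \<chi>)"
    by (rule finite_subset[of _ "Pow C"]) (use C in \<open>auto simp: \<chi>_def finite_colouring_def\<close>)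
  note pattern = assms[OF this]
  let ?S = "{t. \<exists>u v. 0 < u \<and> 0 < v \<and>
    t = map (\<lambda>f. f u v) [\<lambda>x y. of_nat x, \<lambda>x y. of_nat y, F, G] \<and> Defs.monochromatic C t}"
  show "infinite ?S"
  proof
    assume "finite ?S"
    define M where "M = Max (insert 0 ((\<lambda>t. nat \<lfloor>hd t\<rfloor>) ` ?S))"
    obtain x y w z where xy: "M < x" "M < y" and wz: "F x y = of_nat w" "G x y = of_nat z"
      and eq: "\<chi> y = \<chi> x" "\<chi> w = \<chi> x" "\<chi> z = \<chi> x"
      using pattern[of M] by blast
    have "x \<in> \<Union>C" using C xy by (auto simp: finite_colouring_def partition_on_def)
    then obtain A where A: "A \<in> C" "x \<in> A" by blast
    then have "A \<in> \<chi> x" by (simp add: \<chi>_def)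
    then have "A \<in> \<chi> y" "A \<in> \<chi> w" "A \<in> \<chi> z" by (simp_all add: eq)
    then have "y \<in> A" "w \<in> A" "z \<in> A" by (simp_all add: \<chi>_def)
    then have "Defs.monochromatic C [of_nat x, of_nat y, F x y, G x y]"
      unfolding Defs.monochromatic_def using A wz by (intro bexI[of _ A]) auto
    then have "[of_nat x, of_nat y, F x y, G x y] \<in> ?S"
      using xy by (intro CollectI exI[of _ x] exI[of _ y]) simp
    from imageI[OF this, of "\<lambda>t. nat \<lfloor>hd t\<rfloor>"] have "x \<in> insert 0 ((\<lambda>t. nat \<lfloor>hd t\<rfloor>) ` ?S)"
      by simp
    then have "x \<le> M" unfolding M_def using \<open>finite ?S\<close> by (intro Max_ge) auto
    then show False using xy by simp
  qed
qed

section \<open>Necessity\<close>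

lemma floor_mod_4_neq:
  fixes u v :: real
  assumes "1 < \<bar>u - v\<bar>" "\<bar>u - v\<bar> < 3"
  shows "\<lfloor>u\<rfloor> mod 4 \<noteq> \<lfloor>v\<rfloor> mod 4"
proof -
  have "\<lfloor>u\<rfloor> - \<lfloor>v\<rfloor> \<in> {-3, -2, -1, 1, 2, 3}" using assms by (simp; linarith)
  then have "\<not> 4 dvd \<lfloor>u\<rfloor> - \<lfloor>v\<rfloor>" by auto
  then show ?thesis by (simp add: mod_eq_dvd_iff)
qed

lemma leading_coefficients_eq:
  fixes c q :: rat and a b :: nat and n m :: int
  assumes "c > 0" "q > 0" "a > 0" "b > 0"
    and PR: "partition_regular [\<lambda>x y. of_nat x, \<lambda>x y. of_nat y, \<lambda>x y. c * of_nat x * of_nat y,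
       \<lambda>x y. q * (of_nat a * of_nat x + of_int n) * (of_nat b * of_nat y + of_int m)]"
  shows "c = q * of_nat a * of_nat b"
proof (rule ccontr)
  assume neq: "c \<noteq> q * of_nat a * of_nat b"
  define \<rho> where "\<rho> = real_of_rat (q * of_nat a * of_nat b / c)"
  have "\<rho> > 0" using assms by (simp add: \<rho>_def)
  have "\<rho> \<noteq> 1" using neq assms(1) unfolding \<rho>_def of_rat_eq_1_iff by simp
  define K where "K = \<bar>ln \<rho>\<bar>"
  have "K > 0" using \<open>\<rho> > 0\<close> \<open>\<rho> \<noteq> 1\<close> by (simp add: K_def)
  have lim: "ln \<midarrow>1\<rightarrow> ln (1::real)" by (intro isContD isCont_ln) simp
  have "K / 4 > 0" using \<open>K > 0\<close> by simp
  from LIM_D[OF lim this] obtain \<delta>' where "\<delta>' > 0" and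
    close: "\<forall>t::real. t \<noteq> 1 \<and> norm (t - 1) < \<delta>' \<longrightarrow> norm (ln t - ln 1) < K / 4"
    by (elim exE conjE)
  then have \<delta>': "\<bar>ln t\<bar> < K / 4" if "\<bar>t - 1\<bar> < \<delta>'" for t
    using that spec[OF close, of t] \<open>K > 0\<close> by (cases "t = 1") simp_all
  define \<delta> where "\<delta> = min \<delta>' 1"
  have \<delta>: "\<delta> > 0" "\<delta> \<le> 1" "\<And>t. \<bar>t - 1\<bar> < \<delta> \<Longrightarrow> \<bar>ln t\<bar> < K / 4"
    using \<delta>' \<open>\<delta>' > 0\<close> by (auto simp: \<delta>_def)
  define M where "M = nat \<lceil>(\<bar>real_of_int n\<bar> + \<bar>real_of_int m\<bar>) / \<delta>\<rceil>"
  have small: "\<bar>real_of_int k / (real d * real x)\<bar> < \<delta>"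
    if "\<bar>k\<bar> \<le> \<bar>n\<bar> + \<bar>m\<bar>" "d > 0" "M < x" for k x d
  proof -
    have "(\<bar>real_of_int n\<bar> + \<bar>real_of_int m\<bar>) / \<delta> < real x" using that(3) by (simp add: M_def) linarith
    then have "\<bar>real_of_int n\<bar> + \<bar>real_of_int m\<bar> < real x * \<delta>" using \<delta>(1) by (simp add: field_simps)
    moreover have "\<bar>real_of_int k\<bar> \<le> \<bar>real_of_int n\<bar> + \<bar>real_of_int m\<bar>" using that(1) by linarith
    moreover have "1 * (real x * \<delta>) \<le> real d * (real x * \<delta>)"
      using that(2) \<delta>(1) by (intro mult_right_mono) auto
    then have "real x * \<delta> \<le> real d * real x * \<delta>" by (simp add: mult.assoc)
    ultimately have "\<bar>real_of_int k\<bar> < real d * real x * \<delta>" by linarith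
    moreover have "real d * real x > 0" using that by simp
    ultimately show ?thesis by (simp add: abs_mult pos_divide_less_eq mult_ac)
  qed
  define \<chi> where "\<chi> k = \<lfloor>2 * ln (real k) / K\<rfloor> mod 4" for k
  have "finite (range \<chi>)" by (rule finite_subset[of _ "{0..<4}"]) (auto simp: \<chi>_def)
  from partition_regular_large[OF PR this, of M] obtain x y w z where
    xy: "M < x" "M < y" "M < w" "M < z" and
    w: "c * of_nat x * of_nat y = of_nat w" and
    z: "q * (of_nat a * of_nat x + of_int n) * (of_nat b * of_nat y + of_int m) = of_nat z" and
    "\<chi> y = \<chi> x" "\<chi> w = \<chi> x" "\<chi> z = \<chi> x" .
  then have \<chi>: "\<chi> z = \<chi> w" by simp
  define e1 where "e1 = 1 + real_of_int n / (real a * real x)"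
  define e2 where "e2 = 1 + real_of_int m / (real b * real y)"
  have e: "\<bar>e1 - 1\<bar> < \<delta>" "\<bar>e2 - 1\<bar> < \<delta>"
    using small[of n a x] small[of m b y] xy assms by (auto simp: e1_def e2_def)
  then have "e1 > 0" "e2 > 0" using \<delta>(2) by linarith+
  have w': "real w = of_rat c * real x * real y"
    using arg_cong[OF w, of real_of_rat] by (simp add: of_rat_mult)
  have z': "real z = of_rat q * (real a * real x + of_int n) * (real b * real y + of_int m)"
    using arg_cong[OF z, of real_of_rat] by (simp add: of_rat_mult of_rat_add)
  have "real z = \<rho> * real w * e1 * e2"
    using assms xy unfolding w' z' \<rho>_def e1_def e2_def
    by (simp add: of_rat_mult of_rat_divide field_simps)
  then have "ln (real z) = ln \<rho> + ln (real w) + ln e1 + ln e2"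
    using \<open>\<rho> > 0\<close> \<open>e1 > 0\<close> \<open>e2 > 0\<close> xy by (simp add: ln_mult)
  moreover have "\<bar>ln e1\<bar> < K / 4" "\<bar>ln e2\<bar> < K / 4" using \<delta>(3) e by auto
  ultimately have "K / 2 < \<bar>ln (real z) - ln (real w)\<bar>" "\<bar>ln (real z) - ln (real w)\<bar> < 3 * K / 2"
    unfolding K_def by linarith+
  moreover have "\<bar>2 * ln (real z) / K - 2 * ln (real w) / K\<bar> = 2 / K * \<bar>ln (real z) - ln (real w)\<bar>"
    using \<open>K > 0\<close> abs_mult[of "2 / K" "ln (real z) - ln (real w)"] by (simp add: right_diff_distrib)
  ultimately have "1 < \<bar>2 * ln (real z) / K - 2 * ln (real w) / K\<bar>"
      "\<bar>2 * ln (real z) / K - 2 * ln (real w) / K\<bar> < 3"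
    using \<open>K > 0\<close> by (simp_all add: field_simps)
  from floor_mod_4_neq[OF this] show False using \<chi> by (simp add: \<chi>_def)
qed

text \<open>The last nonzero digit of \<open>z\<close> in base \<open>p\<close> (and \<open>0\<close> for \<open>z = 0\<close>).\<close>

definition digit :: "int \<Rightarrow> int \<Rightarrow> int" where
  "digit p z = (z div p ^ multiplicity p z) mod p"

lemma digit_eq:
  assumes "prime p" "z = p ^ k * u" "\<not> p dvd u"
  shows "digit p z = u mod p"
proof -
  have "multiplicity p z = k"
    using assms by (intro multiplicity_eqI) (auto simp: prime_gt_0_int)
  then show ?thesis using assms(1,2) by (simp add: digit_def prime_gt_0_int)
qed

lemma not_dvd_digit:
  assumes "prime p" "z \<noteq> 0"
  shows "\<not> p dvd digit p z"
proof -
  obtain u where u: "z = p ^ multiplicity p z * u" "\<not> p dvd u"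
    using multiplicity_decompose'[of z p] assms by (metis not_prime_unit)
  then show ?thesis using digit_eq[OF assms(1) u] by (simp add: dvd_mod_iff)
qed

lemma digit_mult:
  assumes "prime p" "z \<noteq> 0" "\<not> p dvd c"
  shows "digit p (c * z) = c * digit p z mod p"
proof -
  obtain u where u: "z = p ^ multiplicity p z * u" "\<not> p dvd u"
    using multiplicity_decompose'[of z p] assms by (metis not_prime_unit)
  have "digit p (c * z) = c * u mod p"
    using assms u by (intro digit_eq[where k = "multiplicity p z"]) (auto simp: prime_dvd_mult_iff)
  then show ?thesis using digit_eq[OF assms(1) u] by (simp add: mod_mult_right_eq)
qed

lemma digit_coprime:
  assumes "prime p" "\<not> p dvd z"
  shows "digit p z = z mod p"
  using digit_eq[of p z 0 z] assms by simp

lemma digit_congruence: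
  assumes "prime p" "z \<noteq> 0" "z' \<noteq> 0" "digit p z = digit p z'"
    and "\<not> p dvd c" "\<not> p dvd c'" "c * z = c' * z'"
  shows "p dvd c - c'"
proof -
  have "c * digit p z mod p = c' * digit p z mod p"
    using digit_mult[OF assms(1,2,5)] digit_mult[OF assms(1,3,6)] assms(4,7) by simp
  then have "p dvd (c - c') * digit p z" by (simp add: mod_eq_dvd_iff left_diff_distrib)
  then show ?thesis using not_dvd_digit[OF assms(1,2)] assms(1) by (simp add: prime_dvd_mult_iff)
qed

lemma shift_one_factor:
  fixes p s t a b m x y w z :: int
  assumes p: "prime p" "\<not> p dvd t" "\<not> p dvd s" "\<not> p dvd a" "\<not> p dvd b" "\<not> p dvd m"
    and w: "t * w = s * a * b * x * y" and z: "t * z = s * (a * x) * (b * y + m)"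
    and nz: "x \<noteq> 0" "y \<noteq> 0" "z \<noteq> 0"
    and dvd: "p dvd y \<longleftrightarrow> p dvd x" "p dvd w \<longleftrightarrow> p dvd x" "p dvd z \<longleftrightarrow> p dvd x"
    and dig: "digit p y = digit p x" "digit p w = digit p x" "digit p z = digit p x"
  shows "p dvd t - s * a * m"
proof (cases "p dvd x")
  case True
  then have y: "p dvd y" using dvd by simp
  have "\<not> p dvd s * a * (b * y + m)"
    using p y by (simp add: prime_dvd_mult_iff dvd_add_right_iff)
  then have "p dvd t - s * a * (b * y + m)"
    using digit_congruence[OF p(1) nz(3) nz(1) dig(3) p(2)] z by (simp add: mult_ac)
  moreover have "t - s * a * (b * y + m) = (t - s * a * m) - s * a * b * y" by (simp add: algebra_simps)
  ultimately show ?thesis using y by (metis dvd_diff_right_iff dvd_mult dvd_diff dvd_diffD1 diff_eq_eq dvd_add_left_iff)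
next
  case False
  then have eq: "p dvd y - x" "p dvd w - x" "p dvd z - x"
    using dvd dig p(1) by (simp_all add: digit_coprime mod_eq_dvd_iff)
  have "t * (w - x) - s * a * b * x * (y - x) = x * (s * a * b * x - t)"
    using w by (simp add: algebra_simps)
  then have "p dvd x * (s * a * b * x - t)" using eq by (metis dvd_diff dvd_mult)
  moreover have "t * (z - x) - s * a * x * b * (y - x) = x * (s * a * b * x - t + s * a * m)"
    using z by (simp add: algebra_simps)
  then have "p dvd x * (s * a * b * x - t + s * a * m)" using eq by (metis dvd_diff dvd_mult)
  ultimately have "p dvd s * a * m"
    using False p(1) by (simp add: prime_dvd_mult_iff dvd_add_right_iff)
  then show ?thesis using p by (simp add: prime_dvd_mult_iff)
qed

text \<open>If \<open>p\<close> divides none of the entries, then all of them are \<open>t / S\<close> modulo \<open>p\<close>, which forces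
  \<open>(t + N) (t + K) = t\<^sup>2\<close>. Writing \<open>\<xi>, \<eta>, \<omega>, \<phi>\<close> for \<open>S n - t\<close> at \<open>n = x, y, w, z\<close>, to first order
  \<open>\<omega> = \<xi> + \<eta>\<close> while \<open>t \<phi> = (t + K) \<xi> + (t + N) \<eta>\<close>, and comparing last nonzero digits is contradictory
  both for equal and for different valuations of \<open>\<xi>\<close> and \<open>\<eta>\<close>.\<close>

lemma shift_both_factors:
  fixes p s t a b n m x y w z :: int
  defines "S \<equiv> s * a * b" and "N \<equiv> s * b * n" and "K \<equiv> s * a * m"
  assumes p: "prime p" "p > 2" "\<not> p dvd t" "\<not> p dvd s" "\<not> p dvd a" "\<not> p dvd b" "\<not> p dvd n" "\<not> p dvd m"
    and w: "t * w = s * a * b * x * y" and z: "t * z = s * (a * x + n) * (b * y + m)"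
    and dvd: "p dvd y \<longleftrightarrow> p dvd x" "p dvd w \<longleftrightarrow> p dvd x" "p dvd z \<longleftrightarrow> p dvd x"
    and dig: "digit p y = digit p x" "digit p w = digit p x" "digit p z = digit p x"
    and dig2: "digit p (S * y - t) = digit p (S * x - t)" "digit p (S * w - t) = digit p (S * x - t)"
      "digit p (S * z - t) = digit p (S * x - t)"
    and nz: "S * x - t \<noteq> 0" "S * y - t \<noteq> 0" "S * w - t \<noteq> 0" "S * z - t \<noteq> 0"
    and big: "p dvd (t + N) * (t + K) - t\<^sup>2 \<Longrightarrow> (t + N) * (t + K) = t\<^sup>2"
  shows False
proof -
  have "\<not> p dvd x"
  proof
    assume "p dvd x"
    then have "p dvd x" "p dvd y" "p dvd z" using dvd by auto
    moreover have "s * n * m = t * z - s * a * x * (b * y + m) - s * n * b * y"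
      using z by (simp add: algebra_simps)
    ultimately have "p dvd s * n * m" by (metis dvd_diff dvd_mult dvd_mult2)
    then show False using p by (simp add: prime_dvd_mult_iff)
  qed
  then have eq: "p dvd y - x" "p dvd w - x" "p dvd z - x"
    using dvd dig p(1) by (simp_all add: digit_coprime mod_eq_dvd_iff)
  have "t * (w - x) - S * x * (y - x) = x * (S * x - t)"
    using w by (simp add: algebra_simps S_def)
  then have "p dvd x * (S * x - t)" using eq by (metis dvd_diff dvd_mult)
  then have X: "p dvd S * x - t" using \<open>\<not> p dvd x\<close> p(1) by (simp add: prime_dvd_mult_iff)
  have "S * u - t = S * (u - x) + (S * x - t)" for u by (simp add: algebra_simps)
  then have Y: "p dvd S * y - t" and Z: "p dvd S * z - t" using X eq by (metis dvd_add dvd_mult)+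
  have z': "S * (t * z) = (S * x + N) * (S * y + K)"
    unfolding z by (simp add: algebra_simps S_def N_def K_def)
  define \<xi> where "\<xi> = S * x - t"
  define \<eta> where "\<eta> = S * y - t"
  define \<omega> where "\<omega> = S * w - t"
  define \<phi> where "\<phi> = S * z - t"
  have \<phi>': "t * \<phi> = (t + K) * \<xi> + (t + N) * \<eta> + \<xi> * \<eta> + ((t + N) * (t + K) - t\<^sup>2)"
    using z' by (simp add: \<xi>_def \<eta>_def \<phi>_def algebra_simps power2_eq_square)
  have "(t + N) * (t + K) - t\<^sup>2 = t * \<phi> - (t + K) * \<xi> - (t + N + \<xi>) * \<eta>"
    unfolding \<phi>' by (simp add: algebra_simps)
  also have "p dvd \<dots>"
    using X Y Z unfolding \<xi>_def[symmetric] \<eta>_def[symmetric] \<phi>_def[symmetric] by (intro dvd_diff dvd_mult)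
  finally have tt: "(t + N) * (t + K) = t\<^sup>2" by (rule big)
  with \<phi>' have \<phi>: "t * \<phi> = (t + K) * \<xi> + (t + N) * \<eta> + \<xi> * \<eta>" by simp
  have \<omega>: "t * \<omega> = t * \<xi> + t * \<eta> + \<xi> * \<eta>"
  proof -
    have "t * w = S * x * y" using w by (simp add: S_def)
    then have "S * (t * w) = S * (S * x * y)" by simp
    then show ?thesis by (simp add: \<xi>_def \<eta>_def \<omega>_def algebra_simps)
  qed
  have "\<not> p dvd (t + N) * (t + K)" using p by (simp add: tt prime_dvd_power_iff)
  then have units: "\<not> p dvd t + N" "\<not> p dvd t + K" by auto
  have NK: "\<not> p dvd N" "\<not> p dvd K" using p by (auto simp: N_def K_def prime_dvd_mult_iff)
  have nz': "\<xi> \<noteq> 0" "\<eta> \<noteq> 0" "\<omega> \<noteq> 0" "\<phi> \<noteq> 0" using nz by (simp_all add: \<xi>_def \<eta>_def \<omega>_def \<phi>_def)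
  define d where "d = digit p \<xi>"
  have d: "digit p \<eta> = d" "digit p \<omega> = d" "digit p \<phi> = d"
    using dig2 by (simp_all add: d_def \<xi>_def \<eta>_def \<omega>_def \<phi>_def)
  have "\<not> p dvd d" unfolding d_def using not_dvd_digit[OF p(1) nz'(1)] .
  obtain e i where e: "\<xi> = p ^ i * e" "\<not> p dvd e"
    using multiplicity_decompose'[of \<xi> p] nz' p(1) by (metis not_prime_unit)
  obtain f j where f: "\<eta> = p ^ j * f" "\<not> p dvd f"
    using multiplicity_decompose'[of \<eta> p] nz' p(1) by (metis not_prime_unit)
  have ed: "p dvd e - d" and fd: "p dvd f - d"
    using digit_eq[OF p(1) e] digit_eq[OF p(1) f] d(1)
    by (auto simp: d_def simp flip: mod_eq_dvd_iff)
  have "i > 0" using e X by (cases i) (auto simp: \<xi>_def)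
  have lead: "p dvd t * d - g"
    if "u \<noteq> 0" "digit p u = d" "t * u = p ^ k * (g + p * h)" "\<not> p dvd g" for u k g h
  proof -
    have "t * d mod p = (g + p * h) mod p"
      using digit_mult[OF p(1) that(1) p(3)] digit_eq[OF p(1) that(3)] that(2,4)
      by (simp add: dvd_add_left_iff)
    then show ?thesis by (simp add: mod_eq_dvd_iff)
  qed
  consider "i < j" | "j < i" | "i = j" by linarith
  then show False
  proof cases
    case 1
    then obtain k where k: "j = i + Suc k" using less_imp_Suc_add by auto
    have "p dvd t * d - (t + K) * e"
    proof (rule lead[OF nz'(4) d(3)])
      show "t * \<phi> = p ^ i * ((t + K) * e + p * (p ^ k * f * (t + N + \<xi>)))"
        unfolding \<phi> by (simp add: e(1) f(1) k power_add algebra_simps)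
      show "\<not> p dvd (t + K) * e" using units e p(1) by (simp add: prime_dvd_mult_iff)
    qed
    moreover have "K * d = - ((t * d - (t + K) * e) + (t + K) * (e - d))" by (simp add: algebra_simps)
    ultimately have "p dvd K * d" using ed by (metis dvd_add dvd_minus_iff dvd_mult)
    then show False using NK \<open>\<not> p dvd d\<close> p(1) by (simp add: prime_dvd_mult_iff)
  next
    case 2
    then obtain k where k: "i = j + Suc k" using less_imp_Suc_add by auto
    have "p dvd t * d - (t + N) * f"
    proof (rule lead[OF nz'(4) d(3)])
      show "t * \<phi> = p ^ j * ((t + N) * f + p * (p ^ k * e * (t + K + \<eta>)))"
        unfolding \<phi> by (simp add: e(1) f(1) k power_add algebra_simps)
      show "\<not> p dvd (t + N) * f" using units f p(1) by (simp add: prime_dvd_mult_iff)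
    qed
    moreover have "N * d = - ((t * d - (t + N) * f) + (t + N) * (f - d))" by (simp add: algebra_simps)
    ultimately have "p dvd N * d" using fd by (metis dvd_add dvd_minus_iff dvd_mult)
    then show False using NK \<open>\<not> p dvd d\<close> p(1) by (simp add: prime_dvd_mult_iff)
  next
    case 3
    obtain k where k: "i = Suc k" using \<open>i > 0\<close> by (cases i) auto
    have "\<not> p dvd 2" using p(2) by (auto dest: zdvd_imp_le)
    have "\<not> p dvd 2 * d" using \<open>\<not> p dvd 2\<close> \<open>\<not> p dvd d\<close> p(1) by (simp add: prime_dvd_mult_iff)
    moreover have ef: "p dvd (e - d) + (f - d)" using ed fd by (rule dvd_add)
    moreover have "2 * d = (e + f) - ((e - d) + (f - d))" by simp
    ultimately have "\<not> p dvd e + f" by (metis dvd_diff)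
    have "p dvd t * d - t * (e + f)"
    proof (rule lead[OF nz'(3) d(2)])
      show "t * \<omega> = p ^ i * (t * (e + f) + p * (p ^ k * e * f))"
        unfolding \<omega> by (simp add: e(1) f(1) k flip: 3) (simp add: algebra_simps)
      show "\<not> p dvd t * (e + f)" using \<open>\<not> p dvd e + f\<close> p by (simp add: prime_dvd_mult_iff)
    qed
    moreover have "t * d = - ((t * d - t * (e + f)) + t * ((e - d) + (f - d)))" by (simp add: algebra_simps)
    ultimately have "p dvd t * d" using ef by (metis dvd_add dvd_minus_iff dvd_mult)
    then show False using p \<open>\<not> p dvd d\<close> by (simp add: prime_dvd_mult_iff)
  qed
qed

lemma pos_rat_cases:
  fixes q :: rat
  assumes "q > 0"
  obtains s t :: int where "s > 0" "t > 0" "q = of_int s / of_int t"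
proof -
  obtain s t where st: "quotient_of q = (s, t)" by fastforce
  have q: "q = of_int s / of_int t" using quotient_of_div[OF st] .
  have "t > 0" using quotient_of_denom_pos[OF st] .
  then have "s > 0" using assms by (simp add: q zero_less_divide_iff)
  then show thesis using that \<open>t > 0\<close> q by blast
qed

lemma shift_conditions:
  fixes q :: rat and a b :: nat and n m :: int
  assumes "q > 0" "a > 0" "b > 0"
    and PR: "partition_regular [\<lambda>x y. of_nat x, \<lambda>x y. of_nat y,
       \<lambda>x y. q * of_nat a * of_nat b * of_nat x * of_nat y,
       \<lambda>x y. q * (of_nat a * of_nat x + of_int n) * (of_nat b * of_nat y + of_int m)]"
  shows "(n = 0 \<and> m = 0) \<or> (n = 0 \<and> q * of_nat a * of_int m = 1) \<or> (m = 0 \<and> q * of_nat b * of_int n = 1)"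
proof -
  obtain s t :: int where "s > 0" "t > 0" and q: "q = of_int s / of_int t"
    using pos_rat_cases[OF \<open>q > 0\<close>] .
  have qt: "q * of_int t = of_int s" using \<open>t > 0\<close> by (simp add: q)
  define \<alpha> where "\<alpha> = int a"
  define \<beta> where "\<beta> = int b"
  have pos: "\<alpha> > 0" "\<beta> > 0" using assms by (simp_all add: \<alpha>_def \<beta>_def)
  define S where "S = s * \<alpha> * \<beta>"
  have "S > 0" using pos \<open>s > 0\<close> by (simp add: S_def)
  define L where "L = {2, t, s, \<alpha>, \<beta>, n, m, t - s * \<alpha> * m, t - s * \<beta> * n,
    (t + s * \<beta> * n) * (t + s * \<alpha> * m) - t\<^sup>2}"
  have "finite L" by (simp add: L_def)
  obtain p' :: nat where p': "prime p'" "p' > nat (Max (abs ` L))" using bigger_prime by blast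
  define p where "p = int p'"
  have p: "prime p" using p' by (simp add: p_def)
  have less_p: "\<bar>v\<bar> < p" if "v \<in> L" for v
  proof -
    have "\<bar>v\<bar> \<le> Max (abs ` L)" using that \<open>finite L\<close> by simp
    then show ?thesis using p'(2) by (simp add: p_def)
  qed
  have not_dvd: "\<not> p dvd v" if "v \<in> L" "v \<noteq> 0" for v
    using less_p[OF that(1)] that(2) dvd_imp_le_int[of v p] by auto
  have "p > 2" using less_p[of 2] by (simp add: L_def)
  have units: "\<not> p dvd t" "\<not> p dvd s" "\<not> p dvd \<alpha>" "\<not> p dvd \<beta>"
    using not_dvd pos \<open>t > 0\<close> \<open>s > 0\<close> by (simp_all add: L_def)
  define \<chi> where "\<chi> k = (p dvd int k, digit p (int k), digit p (S * int k - t))" for k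
  have "p > 0" using p by (simp add: prime_gt_0_int)
  have "range \<chi> \<subseteq> UNIV \<times> {0..<p} \<times> {0..<p}" using \<open>p > 0\<close> by (auto simp: \<chi>_def digit_def)
  then have "finite (range \<chi>)" by (rule finite_subset) simp
  from partition_regular_large[OF PR this, of "nat t"] obtain x y w z where
    large: "nat t < x" "nat t < y" "nat t < w" "nat t < z" and
    w: "q * of_nat a * of_nat b * of_nat x * of_nat y = of_nat w" and
    z: "q * (of_nat a * of_nat x + of_int n) * (of_nat b * of_nat y + of_int m) = of_nat z" and
    \<chi>: "\<chi> y = \<chi> x" "\<chi> w = \<chi> x" "\<chi> z = \<chi> x" .
  have "rat_of_int (t * int w) = of_int (s * \<alpha> * \<beta> * int x * int y)"
    using \<open>t > 0\<close> by (simp add: \<alpha>_def \<beta>_def q flip: w)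
  then have w': "t * int w = s * \<alpha> * \<beta> * int x * int y" by (simp only: of_int_eq_iff)
  have "rat_of_int (t * int z) = of_int (s * (\<alpha> * int x + n) * (\<beta> * int y + m))"
    using \<open>t > 0\<close> by (simp add: \<alpha>_def \<beta>_def q flip: z)
  then have z': "t * int z = s * (\<alpha> * int x + n) * (\<beta> * int y + m)" by (simp only: of_int_eq_iff)
  have nz: "int x \<noteq> 0" "int y \<noteq> 0" "int z \<noteq> 0" using large by auto
  have nz2: "S * int v - t \<noteq> 0" if "nat t < v" for v
  proof -
    have "t < int v" using that by linarith
    also have "int v \<le> S * int v" using \<open>S > 0\<close> by (simp add: mult_le_cancel_right1)
    finally show ?thesis by simp
  qed
  have dvd: "p dvd int y \<longleftrightarrow> p dvd int x" "p dvd int w \<longleftrightarrow> p dvd int x" "p dvd int z \<longleftrightarrow> p dvd int x"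
    and dig: "digit p (int y) = digit p (int x)" "digit p (int w) = digit p (int x)"
      "digit p (int z) = digit p (int x)"
    and dig2: "digit p (S * int y - t) = digit p (S * int x - t)"
      "digit p (S * int w - t) = digit p (S * int x - t)" "digit p (S * int z - t) = digit p (S * int x - t)"
    using \<chi> by (simp_all add: \<chi>_def)
  consider "n = 0" "m = 0" | "n = 0" "m \<noteq> 0" | "n \<noteq> 0" "m = 0" | "n \<noteq> 0" "m \<noteq> 0" by blast
  then show ?thesis
  proof cases
    case 1
    then show ?thesis by simp
  next
    case 2
    then have "\<not> p dvd m" using not_dvd by (simp add: L_def)
    then have "p dvd t - s * \<alpha> * m"
      using z' 2 by (intro shift_one_factor[OF p units _ w' _ nz dvd dig]) simp_all
    then have "t = s * \<alpha> * m" using not_dvd[of "t - s * \<alpha> * m"] by (auto simp: L_def)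
    then have "rat_of_int t = of_int s * of_nat a * of_int m" by (simp add: \<alpha>_def)
    then have "(q * of_nat a * of_int m) * of_int t = of_int t" by (simp add: mult_ac flip: qt)
    then have "q * of_nat a * of_int m = 1" using \<open>t > 0\<close> by simp
    then show ?thesis using 2 by simp
  next
    case 3
    then have "\<not> p dvd n" using not_dvd by (simp add: L_def)
    then have "p dvd t - s * \<beta> * n"
      using w' z' 3 dvd dig nz
      by (intro shift_one_factor[OF p units(1,2,4,3), of n "int w" "int y" "int x" "int z"])
        (simp_all add: mult_ac)
    then have "t = s * \<beta> * n" using not_dvd[of "t - s * \<beta> * n"] by (auto simp: L_def)
    then have "rat_of_int t = of_int s * of_nat b * of_int n" by (simp add: \<beta>_def)
    then have "(q * of_nat b * of_int n) * of_int t = of_int t" by (simp add: mult_ac flip: qt)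
    then have "q * of_nat b * of_int n = 1" using \<open>t > 0\<close> by simp
    then show ?thesis using 3 by simp
  next
    case 4
    then have nm: "\<not> p dvd n" "\<not> p dvd m" using not_dvd by (simp_all add: L_def)
    have False
    proof (rule shift_both_factors[OF p \<open>p > 2\<close> units nm w' z' dvd dig dig2[unfolded S_def]])
      show "(t + s * \<beta> * n) * (t + s * \<alpha> * m) = t\<^sup>2"
        if "p dvd (t + s * \<beta> * n) * (t + s * \<alpha> * m) - t\<^sup>2"
        using not_dvd[of "(t + s * \<beta> * n) * (t + s * \<alpha> * m) - t\<^sup>2"] that by (auto simp: L_def)
    qed (use nz2 large in \<open>simp_all add: S_def\<close>)
    then show ?thesis ..
  qed
qed

section \<open>The equivalence\<close>

lemma monochromatic_product_and_shift_rat: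
  fixes \<chi> :: "nat \<Rightarrow> 'c" and c :: rat
  assumes "finite (range \<chi>)" "c > 0"
  shows "\<exists>x y w. M < x \<and> M < y \<and> c * of_nat x * of_nat y = of_nat w \<and>
    \<chi> y = \<chi> x \<and> \<chi> w = \<chi> x \<and> \<chi> (w + x) = \<chi> x"
proof -
  obtain C' D' :: int where "C' > 0" "D' > 0" and c: "c = of_int C' / of_int D'"
    using pos_rat_cases[OF \<open>c > 0\<close>] .
  define C where "C = nat C'"
  define D where "D = nat D'"
  have CD: "C > 0" "D > 0" "c = of_nat C / of_nat D"
    using \<open>D' > 0\<close> \<open>C' > 0\<close> c by (simp_all add: C_def D_def)
  define \<kappa> where "\<kappa> n = (\<chi> n, min n (Suc M))" for n
  have "range \<kappa> \<subseteq> range \<chi> \<times> {..Suc M}" by (auto simp: \<kappa>_def)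
  then have "finite (range \<kappa>)" by (rule finite_subset) (simp add: assms(1))
  from monochromatic_product_and_shift[OF this CD(1,2)] obtain x y w where
    "0 < w" and w: "D * w = C * x * y" and \<kappa>: "\<kappa> y = \<kappa> x" "\<kappa> w = \<kappa> x" "\<kappa> (w + x) = \<kappa> x" by blast
  \<comment> \<open>Colour classes of numbers up to \<open>M\<close> are singletons, but \<open>w + x \<noteq> x\<close>.\<close>
  have "M < x" using \<kappa>(3) \<open>0 < w\<close> by (auto simp: \<kappa>_def min_def split: if_splits)
  then have "M < y" using \<kappa>(1) by (auto simp: \<kappa>_def min_def split: if_splits)
  have "rat_of_nat (D * w) = of_nat (C * x * y)" by (simp only: w)
  then have "c * of_nat x * of_nat y = of_nat w" using CD(2) by (simp add: CD(3) field_simps)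
  then show ?thesis using \<kappa> \<open>M < x\<close> \<open>M < y\<close> by (auto simp: \<kappa>_def)
qed

theorem proposition4p4:
  fixes q1 q2 :: rat and a1 b1 a2 b2 :: nat and n2 m2 :: int
  assumes "q1 > 0" and "q2 > 0"
    and "a1 > 0" and "b1 > 0" and "a2 > 0" and "b2 > 0"
  shows "partition_regular
      [\<lambda>x y. of_nat x,
       \<lambda>x y. of_nat y,
       \<lambda>x y. q1 * of_nat a1 * of_nat b1 * of_nat x * of_nat y,
       \<lambda>x y. q2 * (of_nat a2 * of_nat x + of_int n2) * (of_nat b2 * of_nat y + of_int m2)]
    \<longleftrightarrow>
      q1 * of_nat a1 * of_nat b1 = q2 * of_nat a2 * of_nat b2 \<and>
      ((n2 = 0 \<and> m2 = 0) \<or>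
       (n2 = 0 \<and> q2 * of_nat a2 * of_int m2 = 1) \<or>
       (m2 = 0 \<and> q2 * of_nat b2 * of_int n2 = 1))"
    (is "partition_regular [_, _, ?F, ?G] \<longleftrightarrow> ?eq \<and> ?cond")
proof
  assume PR: "partition_regular [\<lambda>x y. of_nat x, \<lambda>x y. of_nat y, ?F, ?G]"
  have eq: ?eq
    using PR assms by (intro leading_coefficients_eq) simp_all
  have ?cond
    using PR assms(2,5,6) unfolding eq by (intro shift_conditions) simp_all
  with eq show "?eq \<and> ?cond" ..
next
  assume "?eq \<and> ?cond"
  then have eq: ?eq and cond: ?cond by blast+
  define c where "c = q2 * of_nat a2 * of_nat b2"
  have "c > 0" using assms by (simp add: c_def)
  show "partition_regular [\<lambda>x y. of_nat x, \<lambda>x y. of_nat y, ?F, ?G]"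
  proof (rule partition_regularI_large)
    fix \<chi> :: "nat \<Rightarrow> nat set set" and M
    assume "finite (range \<chi>)"
    then obtain x y w where xy: "M < x" "M < y" and w: "c * of_nat x * of_nat y = of_nat w"
      and \<chi>: "\<chi> y = \<chi> x" "\<chi> w = \<chi> x" "\<chi> (w + x) = \<chi> x"
      using monochromatic_product_and_shift_rat[OF _ \<open>c > 0\<close>, of \<chi> M] by blast
    have F: "?F x y = of_nat w" "?F y x = of_nat w"
      using w unfolding eq c_def by (simp_all add: mult_ac)
    from cond show "\<exists>x y w z. M < x \<and> M < y \<and> ?F x y = of_nat w \<and> ?G x y = of_nat z \<and>
      \<chi> y = \<chi> x \<and> \<chi> w = \<chi> x \<and> \<chi> z = \<chi> x"
    proof (elim disjE conjE)
      assume "n2 = 0" "m2 = 0"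
      then have "?G x y = of_nat w" using w by (simp add: c_def mult_ac)
      then show ?thesis using xy \<chi> F(1) by blast
    next
      assume "n2 = 0" and 1: "q2 * of_nat a2 * of_int m2 = 1"
      then have "?G x y = c * of_nat x * of_nat y + (q2 * of_nat a2 * of_int m2) * of_nat x"
        by (simp add: c_def algebra_simps)
      then have "?G x y = of_nat (w + x)" by (simp add: w 1)
      then show ?thesis using xy \<chi> F(1) by blast
    next
      assume "m2 = 0" and 1: "q2 * of_nat b2 * of_int n2 = 1"
      then have "?G y x = c * of_nat x * of_nat y + (q2 * of_nat b2 * of_int n2) * of_nat x"
        by (simp add: c_def algebra_simps)
      then have "?G y x = of_nat (w + x)" by (simp add: w 1)
      then show ?thesis using xy \<chi> F(2) by (intro exI[of _ y] exI[of _ x] exI[of _ w] exI[of _ "w + x"]) simp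
    qed
  qed
qed

end
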